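(* Let $p_1,p_2,q\in(1,\infty)$ satisfy $q^{-1}=p_1^{-1}+p_2^{-1}-1$. There exist a continuous nondecreasing function $\Lambda:(0,1]\to(0,1]$, an exponent $\gamma>0$, and a constant $c>0$ satisfying \[ \Lambda(t)\le 1-c(1-t)^\gamma \quad\text{as } t\to 1^- \] (that is, for all $t<1$ sufficiently close to $1$) such that for any torsion-free discrete group $G$ and for any nonzero functions $f_1\in L^{p_1}(G)$, $f_2\in L^{p_2}(G)$, \[ \|f_1*f_2\|_{q}\le\|f_1\|_{p_1}\|f_2\|_{p_2}\cdot\Lambda\Big(\frac{\|f_1\|_{\infty}}{\|f_1\|_{p_1}}\Big)\cdot\Lambda\Big(\frac{\|f_2\|_{\infty}}{\|f_2\|_{p_2}}\Big). \]
   Context: The group operation on $G$ is written additively, $x+y$, even though $G$ is not assumed Abelian. $G$ is equipped with counting measure; functions are complex-valued, $\|f\|_{p}=\|f\|_{L^p(G)}=(\sum_{x\in G}|f(x)|^p)^{1/p}$ for $p\in[1,\infty)$ and $\|f\|_\infty=\sup_{x\in G}|f(x)|$. The convolution is $(f_1*f_2)(z)=\sum_{(x,y)\in G\times G:\, x+y=z} f_1(x)f_2(y)$. A group is torsion-free if its only finite subgroup is the trivial subgroup. *)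

theory Defs
  imports "HOL-Analysis.Infinite_Sum" "HOL-Algebra.Group"
begin

text \<open>
  A discrete group is a group record \<open>G\<close>, with the counting measure on \<open>carrier G\<close>. It is written
  multiplicatively, as in HOL-Algebra. A function on the group is a function on the whole type
  whose values outside \<open>carrier G\<close> are never inspected.
\<close>

definition torsion_free :: "('a, 'b) monoid_scheme \<Rightarrow> bool" where
  "torsion_free G \<longleftrightarrow> (\<forall>H. subgroup H G \<and> finite H \<longrightarrow> H = {\<one>\<^bsub>G\<^esub>})"

definition in_Lp :: "('a, 'b) monoid_scheme \<Rightarrow> real \<Rightarrow> ('a \<Rightarrow> complex) \<Rightarrow> bool" where
  "in_Lp G p f \<longleftrightarrow> (\<lambda>x. norm (f x) powr p) summable_on carrier G"

definition Lp_norm :: "('a, 'b) monoid_scheme \<Rightarrow> real \<Rightarrow> ('a \<Rightarrow> complex) \<Rightarrow> real" where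
  "Lp_norm G p f = (\<Sum>\<^sub>\<infinity>x\<in>carrier G. norm (f x) powr p) powr (1 / p)"

definition Linf_norm :: "('a, 'b) monoid_scheme \<Rightarrow> ('a \<Rightarrow> complex) \<Rightarrow> real" where
  "Linf_norm G f = (SUP x\<in>carrier G. norm (f x))"

definition conv_pairs :: "('a, 'b) monoid_scheme \<Rightarrow> 'a \<Rightarrow> ('a \<times> 'a) set" where
  "conv_pairs G z = {(x, y) \<in> carrier G \<times> carrier G. x \<otimes>\<^bsub>G\<^esub> y = z}"

definition convolution ::
  "('a, 'b) monoid_scheme \<Rightarrow> ('a \<Rightarrow> complex) \<Rightarrow> ('a \<Rightarrow> complex) \<Rightarrow> 'a \<Rightarrow> complex" where
  "convolution G f1 f2 z = (\<Sum>\<^sub>\<infinity>(x, y)\<in>conv_pairs G z. f1 x * f2 y)"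

text \<open>
  Divergent sums have the junk value \<open>0\<close>, so an inequality between values of \<open>Lp_norm\<close> says nothing
  when its left-hand side diverges. The first two conjuncts of the conclusion record that the
  convolution is defined everywhere by an absolutely convergent sum and that its \<open>L\<^sup>q\<close> norm is
  finite; both are implicit in the informal inequality.
\<close>

definition improved_young ::
  "real \<Rightarrow> real \<Rightarrow> real \<Rightarrow> (real \<Rightarrow> real) \<Rightarrow> ('a, 'b) monoid_scheme \<Rightarrow> bool" where
  "improved_young p1 p2 q \<Lambda> G \<longleftrightarrow>
    (\<forall>f1 f2. in_Lp G p1 f1 \<and> in_Lp G p2 f2 \<and>
       (\<exists>x\<in>carrier G. f1 x \<noteq> 0) \<and> (\<exists>x\<in>carrier G. f2 x \<noteq> 0) \<longrightarrow>
       (\<forall>z\<in>carrier G. (\<lambda>(x, y). norm (f1 x * f2 y)) summable_on conv_pairs G z) \<and>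
       in_Lp G q (convolution G f1 f2) \<and>
       Lp_norm G q (convolution G f1 f2)
         \<le> Lp_norm G p1 f1 * Lp_norm G p2 f2
            * \<Lambda> (Linf_norm G f1 / Lp_norm G p1 f1) * \<Lambda> (Linf_norm G f2 / Lp_norm G p2 f2))"

text \<open>
  The same \<open>\<Lambda>\<close> is to serve all groups, but HOL cannot quantify over types inside an existential
  quantifier: in a formula \<open>\<exists>\<Lambda>. \<forall>G :: 'a monoid. \<dots>\<close> the function \<open>\<Lambda>\<close> may depend on the type \<open>'a\<close>.
  The theorem therefore has two conjuncts. The first one mentions no type variable, so the \<open>\<Lambda>\<close> it
  yields is chosen once and for all; it satisfies the inequality on every torsion-free group whose
  carrier is a set of natural numbers, that is, up to isomorphism, on every countable one. The
  second one, where \<open>'a\<close> is arbitrary, says that every such \<open>\<Lambda>\<close> also satisfies the inequality on every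
  torsion-free group, of any cardinality.
\<close>

end

(* Normalise |f_i| = N_i g_i^(1/p_i) with g_1, g_2 probability densities, and put P = g_1 * g_2
   (conv_mass) and S(z) = sum_x sqrt (g_1(x) g_2(x^-1 z)) (affinity), so that P is again a
   probability density and S <= 1. Hoelder's inequality with four factors gives |f_1 * f_2|^q
   <= (N_1 N_2)^q P S^s for some s > 0, so a gain over Young's inequality is lost only where S
   is close to 1. Suppose that the set Z = {S >= 255/256} carries P-mass more than 15/16. Each
   z in Z makes g_1 close in L^1 to x |-> g_2(x^-1 z); hence g_1 is almost invariant under left
   translation by every element of Z Z^-1. Conversely, if translation by d nearly preserves
   g_1, even with twice that error, then P(dZ) is almost P(Z), so dZ meets Z and d lies in Z
   Z^-1. The almost-periods of g_1 therefore form a subgroup, which is finite because g_1 is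
   summable, and hence trivial; so Z is a single point z, and P(z) is at most max g_1 and at
   most max g_2. Thus the gain is at least linear in 1 - max g_i. *)
theory Submission
  imports Defs "HOL-Analysis.Analysis" "HOL-Algebra.Generated_Groups"
begin

section \<open>Elementary inequalities between real numbers\<close>

text \<open>Apply \<open>ln y \<le> y - 1\<close> at \<open>y = x / m\<close> for each entry, with
  \<open>m\<close> the weighted mean: as the weights add up to 1, the linear terms cancel and
  \<open>ln m\<close> remains. This is the pointwise form of Hoelder's inequality with four
  factors.\<close>

lemma weighted_am_gm4:
  fixes x1 x2 x3 x4 w1 w2 w3 w4 :: real
  assumes "0 < x1" "0 < x2" "0 < x3" "0 < x4" "0 \<le> w1" "0 \<le> w2" "0 \<le> w3" "0 \<le> w4"
    and w: "w1 + w2 + w3 + w4 = 1"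
  shows "x1 powr w1 * x2 powr w2 * x3 powr w3 * x4 powr w4 \<le> w1 * x1 + w2 * x2 + w3 * x3 + w4 * x4"
proof -
  define m where "m = w1 * x1 + w2 * x2 + w3 * x3 + w4 * x4"
  have "0 < w1 \<or> 0 < w2 \<or> 0 < w3 \<or> 0 < w4"
    using w by linarith
  then have m: "0 < m"
    unfolding m_def using assms
    by (smt (verit) mult_nonneg_nonneg mult_pos_pos)
  have ln_le: "w * ln x \<le> w * (x / m - 1) + w * ln m" if "0 < x" "0 \<le> w" for x w
  proof -
    have "ln x \<le> (x / m - 1) + ln m"
      using ln_le_minus_one[of "x / m"] that m by (simp add: ln_div)
    then show ?thesis
      using that(2) by (simp flip: distrib_left add: mult_left_mono)
  qed
  have "w1 * ln x1 + w2 * ln x2 + w3 * ln x3 + w4 * ln x4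
      \<le> w1 * (x1 / m - 1) + w2 * (x2 / m - 1) + w3 * (x3 / m - 1) + w4 * (x4 / m - 1)
        + (w1 + w2 + w3 + w4) * ln m"
    using ln_le[of x1 w1] ln_le[of x2 w2] ln_le[of x3 w3] ln_le[of x4 w4] assms(1-8)
    unfolding distrib_right by linarith
  also have "\<dots> = (w1 * x1 + w2 * x2 + w3 * x3 + w4 * x4) / m
      - (w1 + w2 + w3 + w4) + (w1 + w2 + w3 + w4) * ln m"
    by (simp add: add_divide_distrib algebra_simps)
  also have "\<dots> = ln m"
    using m w by (simp flip: m_def)
  finally have "exp (w1 * ln x1 + w2 * ln x2 + w3 * ln x3 + w4 * ln x4) \<le> m"
    using m by (simp add: ln_ge_iff)
  then show ?thesis
    using assms by (simp add: powr_def exp_add m_def)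
qed

text \<open>Factor |a - b| as |u - v| (u + v) with u, v the square roots, and split the product by
  AM-GM. The term a + b - 2 sqrt (a b) equals (u - v)^2, so summation over the group bounds an L^1
  distance by the affinity, with no Cauchy-Schwarz inequality for sums.\<close>

lemma abs_diff_le_sqrt:
  fixes a b :: real
  assumes "0 \<le> a" "0 \<le> b"
  shows "\<bar>a - b\<bar> \<le> (a + b) / 16 + 8 * (a + b - 2 * sqrt (a * b))"
proof -
  define u v where "u = sqrt a" and "v = sqrt b"
  have ab: "a = u\<^sup>2" "b = v\<^sup>2" "sqrt (a * b) = u * v" "0 \<le> u" "0 \<le> v"
    using assms by (auto simp: u_def v_def real_sqrt_mult)
  have "\<bar>a - b\<bar> = \<bar>u - v\<bar> * (u + v)"
    using ab by (simp add: abs_mult power2_eq_square square_diff_square_factored)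
  also have "\<dots> \<le> (u + v)\<^sup>2 / 32 + 8 * (u - v)\<^sup>2"
  proof -
    \<comment> \<open>The coefficients 16 and 32 make the cross term exactly |u - v| (u +
      v).\<close>
    have "0 \<le> ((u + v) - 16 * \<bar>u - v\<bar>)\<^sup>2 / 32"
      by simp
    then show ?thesis
      by (simp add: power2_diff[of "u + v"] power_mult_distrib algebra_simps)
  qed
  also have "\<dots> \<le> (u\<^sup>2 + v\<^sup>2) / 16 + 8 * (u - v)\<^sup>2"
    using zero_le_power2[of "u - v"] by (simp add: power2_eq_square algebra_simps)
  finally show ?thesis
    using ab by (simp add: power2_diff)
qed

text \<open>Bernoulli's inequality for exponents in [0,1], as weighted AM-GM of 1 - x and 1. It
  serves to take the q-th root of the final estimate, with \<open>r = 1 / q\<close>.\<close>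

lemma powr_le_linear:
  fixes x r :: real
  assumes "0 \<le> r" "r \<le> 1" "x < 1"
  shows "(1 - x) powr r \<le> 1 - r * x"
  using Youngs_inequality_0[of r "1 - r" "1 - x" 1] assms by (simp add: algebra_simps)

section \<open>Bijections used to reindex sums over the group\<close>

context group
begin

lemma bij_betw_mult_left:
  assumes "a \<in> carrier G"
  shows "bij_betw (\<lambda>x. a \<otimes> x) (carrier G) (carrier G)"
  by (rule bij_betwI[where g = "\<lambda>x. inv a \<otimes> x"]) (use assms in \<open>auto simp: m_assoc[symmetric]\<close>)

lemma bij_betw_inv_mult:
  assumes "z \<in> carrier G"
  shows "bij_betw (\<lambda>x. inv x \<otimes> z) (carrier G) (carrier G)"
  by (rule bij_betwI[where g = "\<lambda>y. z \<otimes> inv y"])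
    (use assms in \<open>auto simp: inv_mult_group m_assoc[symmetric] inv_solve_right' m_assoc\<close>)

lemma bij_betw_conv_pairs:
  assumes "z \<in> carrier G"
  shows "bij_betw (\<lambda>x. (x, inv x \<otimes> z)) (carrier G) (conv_pairs G z)"
  by (rule bij_betwI[where g = fst]) (use assms in \<open>auto simp: conv_pairs_def m_assoc[symmetric]\<close>)

end

section \<open>Convolution and affinity of two probability densities\<close>

locale density_pair = group +
  fixes g1 g2 :: "'a \<Rightarrow> real"
  assumes g1_nonneg: "x \<in> carrier G \<Longrightarrow> 0 \<le> g1 x"
    and g2_nonneg: "x \<in> carrier G \<Longrightarrow> 0 \<le> g2 x"
    and g1_sum: "(g1 has_sum 1) (carrier G)"
    and g2_sum: "(g2 has_sum 1) (carrier G)"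
begin

definition conv_mass :: "'a \<Rightarrow> real" where
  "conv_mass z = (\<Sum>\<^sub>\<infinity>x\<in>carrier G. g1 x * g2 (inv x \<otimes> z))"

text \<open>The Bhattacharyya coefficient (Hellinger affinity) of \<open>g1\<close> and the
  reflected translate x |-> g2(x^-1 z) of \<open>g2\<close>; it equals 1 exactly when the two
  densities agree.\<close>

definition affinity :: "'a \<Rightarrow> real" where
  "affinity z = (\<Sum>\<^sub>\<infinity>x\<in>carrier G. sqrt (g1 x * g2 (inv x \<otimes> z)))"

text \<open>The L^1 distance between \<open>g1\<close> and its left translate by \<open>d\<close>.
  Elements with a small value are the almost-periods of \<open>g1\<close>.\<close>

definition shift_dist :: "'a \<Rightarrow> real" where
  "shift_dist d = (\<Sum>\<^sub>\<infinity>x\<in>carrier G. \<bar>g1 x - g1 (inv d \<otimes> x)\<bar>)"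

lemma g1_shift: "d \<in> carrier G \<Longrightarrow> ((\<lambda>x. g1 (d \<otimes> x)) has_sum 1) (carrier G)"
  using has_sum_reindex_bij_betw[OF bij_betw_mult_left] g1_sum by blast

lemma g2_shift: "z \<in> carrier G \<Longrightarrow> ((\<lambda>x. g2 (inv x \<otimes> z)) has_sum 1) (carrier G)"
  using has_sum_reindex_bij_betw[OF bij_betw_inv_mult] g2_sum by blast

lemma g2_le_1: "x \<in> carrier G \<Longrightarrow> g2 x \<le> 1"
  using finite_sum_le_has_sum[OF g2_sum, of "{x}"] g2_nonneg by auto

text \<open>Under counting measure a probability density is at most 1 everywhere, so
  \<open>h\<close> itself dominates the terms.\<close>

lemma conv_summable:
  assumes "h summable_on carrier G" "\<And>x. x \<in> carrier G \<Longrightarrow> 0 \<le> h x" "z \<in> carrier G"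
  shows "(\<lambda>x. h x * g2 (inv x \<otimes> z)) summable_on carrier G"
  by (rule summable_on_comparison_test[OF assms(1)])
    (use assms g2_nonneg g2_le_1 in \<open>auto intro: mult_left_le\<close>)

text \<open>Tonelli: for fixed \<open>x\<close> the sum over \<open>z\<close> is \<open>h x\<close>,
  since \<open>g2\<close> has mass 1. The function \<open>h\<close> is arbitrary because the lemma
  serves both for \<open>g1\<close> and for the difference of \<open>g1\<close> and a
  translate.\<close>

lemma conv_has_sum:
  assumes h: "(h has_sum s) (carrier G)" and h0: "\<And>x. x \<in> carrier G \<Longrightarrow> 0 \<le> h x"
  shows "((\<lambda>z. \<Sum>\<^sub>\<infinity>x\<in>carrier G. h x * g2 (inv x \<otimes> z)) has_sum s) (carrier G)"
proof -
  let ?F = "\<lambda>(x, z). h x * g2 (inv x \<otimes> z)"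
  have row: "((\<lambda>z. ?F (x, z)) has_sum h x) (carrier G)" if "x \<in> carrier G" for x
  proof -
    have "((\<lambda>z. g2 (inv x \<otimes> z)) has_sum 1) (carrier G)"
      using has_sum_reindex_bij_betw[OF bij_betw_mult_left] g2_sum that by blast
    from has_sum_cmult_right[OF this, of "h x"] show ?thesis
      by simp
  qed
  have "?F summable_on carrier G \<times> carrier G"
    by (rule summable_on_SigmaI[OF row])
      (use h h0 g2_nonneg in \<open>auto intro: has_sum_imp_summable\<close>)
  then have "(?F has_sum s) (carrier G \<times> carrier G)"
    using row h by (intro has_sum_SigmaI) auto
  then have "((\<lambda>(z, x). h x * g2 (inv x \<otimes> z)) has_sum s) (carrier G \<times> carrier G)"
    by (simp add: has_sum_swap[of ?F])
  then show ?thesis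
  proof (rule has_sum_Sigma')
    fix z assume "z \<in> carrier G"
    then show "((\<lambda>x. case (z, x) of (z, x) \<Rightarrow> h x * g2 (inv x \<otimes> z)) has_sum
        (\<Sum>\<^sub>\<infinity>x\<in>carrier G. h x * g2 (inv x \<otimes> z))) (carrier G)"
      using conv_summable[OF has_sum_imp_summable[OF h] h0] by simp
  qed
qed

lemma conv_mass_sum: "(conv_mass has_sum 1) (carrier G)"
  unfolding conv_mass_def using conv_has_sum[OF g1_sum g1_nonneg] by simp

lemma conv_mass_term_summable: "z \<in> carrier G \<Longrightarrow> (\<lambda>x. g1 x * g2 (inv x \<otimes> z)) summable_on carrier G"
  using conv_summable g1_sum g1_nonneg has_sum_imp_summable by blast

lemma conv_mass_nonneg: "z \<in> carrier G \<Longrightarrow> 0 \<le> conv_mass z"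
  unfolding conv_mass_def using g1_nonneg g2_nonneg by (auto intro!: infsum_nonneg)

text \<open>\<open>conv_mass z\<close> is a mean of values of \<open>g1\<close> with respect to the
  density x |-> g2(x^-1 z), and also a mean of values of \<open>g2\<close> with respect to
  \<open>g1\<close>.\<close>

lemma conv_mass_le:
  assumes z: "z \<in> carrier G"
    and m: "(\<forall>x\<in>carrier G. g1 x \<le> m) \<or> (\<forall>x\<in>carrier G. g2 x \<le> m)"
  shows "conv_mass z \<le> m"
  using m
proof
  assume m: "\<forall>x\<in>carrier G. g1 x \<le> m"
  have "conv_mass z \<le> m * 1"
    unfolding conv_mass_def
    by (rule has_sum_mono[OF has_sum_infsum[OF conv_mass_term_summable] has_sum_cmult_right[OF g2_shift]])
      (use z m g2_nonneg in \<open>auto intro: mult_right_mono\<close>)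
  then show ?thesis by simp
next
  assume m: "\<forall>x\<in>carrier G. g2 x \<le> m"
  have "conv_mass z \<le> 1 * m"
    unfolding conv_mass_def
    by (rule has_sum_mono[OF has_sum_infsum[OF conv_mass_term_summable] has_sum_cmult_left[OF g1_sum]])
      (use z m g1_nonneg in \<open>auto intro: mult_left_mono\<close>)
  then show ?thesis by simp
qed

lemma mean_sum:
  assumes "z \<in> carrier G"
  shows "((\<lambda>x. (g1 x + g2 (inv x \<otimes> z)) / 2) has_sum 1) (carrier G)"
  using has_sum_cmult_left[OF has_sum_add[OF g1_sum g2_shift[OF assms]], of "1/2"] by simp

lemma affinity_term_le:
  "x \<in> carrier G \<Longrightarrow> z \<in> carrier G \<Longrightarrow>
    sqrt (g1 x * g2 (inv x \<otimes> z)) \<le> (g1 x + g2 (inv x \<otimes> z)) / 2"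
  by (intro arith_geo_mean_sqrt g1_nonneg g2_nonneg) auto

lemma affinity_term_summable:
  assumes "z \<in> carrier G"
  shows "(\<lambda>x. sqrt (g1 x * g2 (inv x \<otimes> z))) summable_on carrier G"
  by (rule summable_on_comparison_test[OF has_sum_imp_summable[OF mean_sum[OF assms]]])
    (use assms affinity_term_le g1_nonneg g2_nonneg in auto)

lemma affinity_nonneg: "z \<in> carrier G \<Longrightarrow> 0 \<le> affinity z"
  unfolding affinity_def using g1_nonneg g2_nonneg by (auto intro!: infsum_nonneg)

lemma affinity_le_1:
  assumes "z \<in> carrier G"
  shows "affinity z \<le> 1"
  unfolding affinity_def
  by (rule has_sum_mono[OF has_sum_infsum[OF affinity_term_summable[OF assms]] mean_sum[OF assms]])
    (use assms affinity_term_le g1_nonneg g2_nonneg in auto)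

lemma conv_mass_powr_summable:
  assumes "0 < s"
  shows "(\<lambda>z. conv_mass z * affinity z powr s) summable_on carrier G"
proof (rule summable_on_comparison_test[OF has_sum_imp_summable[OF conv_mass_sum]])
  fix z assume z: "z \<in> carrier G"
  then have "affinity z powr s \<le> 1"
    using affinity_nonneg affinity_le_1 assms by (intro powr_le1) auto
  then show "conv_mass z * affinity z powr s \<le> conv_mass z" "0 \<le> conv_mass z * affinity z powr s"
    using z conv_mass_nonneg by (auto intro: mult_left_le)
qed

section \<open>L^1 closeness and almost-periods\<close>

lemma abs_diff_summable:
  fixes h k :: "'a \<Rightarrow> real"
  assumes "h summable_on A" "k summable_on A"
  shows "(\<lambda>x. \<bar>h x - k x\<bar>) summable_on A"
  using summable_on_add[OF assms(1) summable_on_uminus[THEN iffD2, OF assms(2)]]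
    summable_on_iff_abs_summable_on_real[of "\<lambda>x. h x - k x" A]
  by simp

lemma g12_close_summable:
  "z \<in> carrier G \<Longrightarrow> (\<lambda>x. \<bar>g1 x - g2 (inv x \<otimes> z)\<bar>) summable_on carrier G"
  by (intro abs_diff_summable has_sum_imp_summable[OF g1_sum] has_sum_imp_summable[OF g2_shift])

text \<open>Summing \<open>abs_diff_le_sqrt\<close> gives 2/16 + 16 (1 - affinity z), which is at
  most 1/8 + 1/16 at the threshold 255/256.\<close>

lemma g12_close:
  assumes z: "z \<in> carrier G" and affinity: "255/256 \<le> affinity z"
  shows "(\<Sum>\<^sub>\<infinity>x\<in>carrier G. \<bar>g1 x - g2 (inv x \<otimes> z)\<bar>) \<le> 3/16"
proof -
  have add: "((\<lambda>x. g1 x + g2 (inv x \<otimes> z)) has_sum 2) (carrier G)"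
    using has_sum_add[OF g1_sum g2_shift[OF z]] by simp
  have "((\<lambda>x. (g1 x + g2 (inv x \<otimes> z)) * (1/16 + 8) +
      sqrt (g1 x * g2 (inv x \<otimes> z)) * (-16)) has_sum 2 * (1/16 + 8) + affinity z * (-16)) (carrier G)"
    unfolding affinity_def
    by (intro has_sum_add has_sum_cmult_left add has_sum_infsum affinity_term_summable z)
  then have "(\<Sum>\<^sub>\<infinity>x\<in>carrier G. \<bar>g1 x - g2 (inv x \<otimes> z)\<bar>) \<le> 2 * (1/16 + 8) + affinity z * (-16)"
  proof (rule has_sum_mono[OF has_sum_infsum[OF g12_close_summable[OF z]]])
    fix x assume "x \<in> carrier G"
    then show "\<bar>g1 x - g2 (inv x \<otimes> z)\<bar> \<le> (g1 x + g2 (inv x \<otimes> z)) * (1/16 + 8) +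
        sqrt (g1 x * g2 (inv x \<otimes> z)) * (-16)"
      using abs_diff_le_sqrt[of "g1 x" "g2 (inv x \<otimes> z)"] z g1_nonneg[of x] g2_nonneg[of "inv x \<otimes> z"]
      by (simp add: field_simps)
  qed
  then show ?thesis
    using affinity by simp
qed

lemma shift_dist_term_summable:
  assumes "d \<in> carrier G"
  shows "(\<lambda>x. \<bar>g1 x - g1 (inv d \<otimes> x)\<bar>) summable_on carrier G"
  by (intro abs_diff_summable has_sum_imp_summable[OF g1_sum] has_sum_imp_summable[OF g1_shift])
    (use assms in auto)

text \<open>With d = w z^-1 one has (d^-1 x)^-1 z = x^-1 w. So \<open>g1\<close> and its translate
  by \<open>d\<close> are both within 3/16 of the same function x |-> g2(x^-1 w).\<close>

lemma shift_dist_quotient: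
  assumes z: "z \<in> carrier G" "255/256 \<le> affinity z" and w: "w \<in> carrier G" "255/256 \<le> affinity w"
  shows "shift_dist (w \<otimes> inv z) \<le> 3/8"
proof -
  define d where "d = w \<otimes> inv z"
  have d: "d \<in> carrier G" "inv d \<otimes> w = z"
    using z w by (simp_all add: d_def inv_mult_group m_assoc)
  let ?N = "\<lambda>z x. \<bar>g1 x - g2 (inv x \<otimes> z)\<bar>"
  have shift: "((\<lambda>x. ?N z (inv d \<otimes> x)) has_sum (\<Sum>\<^sub>\<infinity>x\<in>carrier G. ?N z x)) (carrier G)"
    using has_sum_reindex_bij_betw[OF bij_betw_mult_left[of "inv d"], of "?N z"]
      has_sum_infsum[OF g12_close_summable[OF z(1)]] d by simp
  have "shift_dist d \<le> (\<Sum>\<^sub>\<infinity>x\<in>carrier G. ?N w x) + (\<Sum>\<^sub>\<infinity>x\<in>carrier G. ?N z x)"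
    unfolding shift_dist_def
  proof (rule has_sum_mono[OF has_sum_infsum[OF shift_dist_term_summable[OF d(1)]]
        has_sum_add[OF has_sum_infsum[OF g12_close_summable[OF w(1)]] shift]])
    fix x assume x: "x \<in> carrier G"
    have "inv (inv d \<otimes> x) \<otimes> z = inv x \<otimes> w"
      using x d w z by (simp add: inv_mult_group m_assoc d(2)[symmetric]) (simp add: m_assoc[symmetric])
    then show "\<bar>g1 x - g1 (inv d \<otimes> x)\<bar> \<le> ?N w x + ?N z (inv d \<otimes> x)"
      by simp
  qed
  also have "\<dots> \<le> 3/16 + 3/16"
    using g12_close z w by (intro add_mono) auto
  finally show ?thesis
    by (simp add: d_def)
qed

text \<open>Triangle inequality through the translate by \<open>a\<close>; the second distance
  becomes \<open>shift_dist b\<close> after reindexing by x |-> a^-1 x.\<close>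

lemma shift_dist_mult:
  assumes a: "a \<in> carrier G" and b: "b \<in> carrier G"
  shows "shift_dist (a \<otimes> b) \<le> shift_dist a + shift_dist b"
proof -
  let ?N = "\<lambda>x. \<bar>g1 x - g1 (inv b \<otimes> x)\<bar>"
  have shift: "((\<lambda>x. ?N (inv a \<otimes> x)) has_sum shift_dist b) (carrier G)"
    using has_sum_reindex_bij_betw[OF bij_betw_mult_left[of "inv a"], of ?N]
      has_sum_infsum[OF shift_dist_term_summable[OF b]] a by (simp add: shift_dist_def)
  show ?thesis
    unfolding shift_dist_def[of a] shift_dist_def[of "a \<otimes> b"]
    by (rule has_sum_mono[OF has_sum_infsum[OF shift_dist_term_summable]
          has_sum_add[OF has_sum_infsum[OF shift_dist_term_summable[OF a]] shift]])
      (use a b in \<open>auto simp: inv_mult_group m_assoc\<close>)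
qed

lemma shift_dist_inv:
  assumes a: "a \<in> carrier G"
  shows "shift_dist (inv a) = shift_dist a"
proof -
  have "shift_dist (inv a) = (\<Sum>\<^sub>\<infinity>x\<in>carrier G. \<bar>g1 (inv a \<otimes> x) - g1 (inv (inv a) \<otimes> (inv a \<otimes> x))\<bar>)"
    unfolding shift_dist_def
    using infsum_reindex_bij_betw[OF bij_betw_mult_left[of "inv a"],
        of "\<lambda>x. \<bar>g1 x - g1 (inv (inv a) \<otimes> x)\<bar>"] a by simp
  also have "\<dots> = shift_dist a"
    unfolding shift_dist_def
    by (rule infsum_cong) (use a in \<open>auto simp: m_assoc[symmetric] abs_minus_commute\<close>)
  finally show ?thesis .
qed

text \<open>Translating the argument of \<open>conv_mass\<close> amounts to translating
  \<open>g1\<close>. The loss at \<open>z\<close> is therefore at most the convolution of |g1 - g1(d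
  .)| with \<open>g2\<close>, whose total mass is \<open>shift_dist d\<close>.\<close>

lemma conv_mass_shift_le:
  assumes d: "d \<in> carrier G" and Z: "Z \<subseteq> carrier G"
  shows "infsum conv_mass Z - shift_dist d \<le> (\<Sum>\<^sub>\<infinity>z\<in>Z. conv_mass (d \<otimes> z))"
proof -
  let ?h = "\<lambda>x. \<bar>g1 x - g1 (d \<otimes> x)\<bar>"
  let ?Q = "\<lambda>z. \<Sum>\<^sub>\<infinity>x\<in>carrier G. ?h x * g2 (inv x \<otimes> z)"
  \<comment> \<open>\<open>?h\<close> compares \<open>g1\<close> with its translate by
    \<open>inv d\<close>, so its sum is \<open>shift_dist (inv d)\<close>, which equals
    \<open>shift_dist d\<close>.\<close>
  have h: "?h summable_on carrier G" "infsum ?h (carrier G) = shift_dist d"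
    using shift_dist_term_summable[of "inv d"] shift_dist_inv[OF d] d by (simp_all add: shift_dist_def)
  have Q: "(?Q has_sum shift_dist d) (carrier G)"
    using conv_has_sum[of ?h "shift_dist d"] h by (auto simp: has_sum_iff)
  have Pd: "conv_mass (d \<otimes> z) = (\<Sum>\<^sub>\<infinity>x\<in>carrier G. g1 (d \<otimes> x) * g2 (inv x \<otimes> z))"
    if z: "z \<in> carrier G" for z
  proof -
    have "conv_mass (d \<otimes> z) = (\<Sum>\<^sub>\<infinity>x\<in>carrier G. g1 (d \<otimes> x) * g2 (inv (d \<otimes> x) \<otimes> (d \<otimes> z)))"
      unfolding conv_mass_def
      using infsum_reindex_bij_betw[OF bij_betw_mult_left[OF d],
          of "\<lambda>x. g1 x * g2 (inv x \<otimes> (d \<otimes> z))"] by simp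
    also have "\<dots> = (\<Sum>\<^sub>\<infinity>x\<in>carrier G. g1 (d \<otimes> x) * g2 (inv x \<otimes> z))"
    proof (rule infsum_cong)
      fix x assume x: "x \<in> carrier G"
      have "inv (d \<otimes> x) \<otimes> (d \<otimes> z) = inv x \<otimes> ((inv d \<otimes> d) \<otimes> z)"
        using x d z by (simp only: inv_mult_group m_assoc m_closed inv_closed)
      then show "g1 (d \<otimes> x) * g2 (inv (d \<otimes> x) \<otimes> (d \<otimes> z)) = g1 (d \<otimes> x) * g2 (inv x \<otimes> z)"
        using x d z by simp
    qed
    finally show ?thesis .
  qed
  have le: "conv_mass z \<le> conv_mass (d \<otimes> z) + ?Q z" if z: "z \<in> carrier G" for z
    unfolding Pd[OF z]
    unfolding conv_mass_def
  proof (rule has_sum_mono[OF has_sum_infsum[OF conv_mass_term_summable[OF z]]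
        has_sum_add[OF has_sum_infsum has_sum_infsum]])
    show "(\<lambda>x. g1 (d \<otimes> x) * g2 (inv x \<otimes> z)) summable_on carrier G"
      using g1_shift[OF d] g1_nonneg d z by (intro conv_summable) (auto simp: has_sum_iff)
    show "(\<lambda>x. ?h x * g2 (inv x \<otimes> z)) summable_on carrier G"
      using h z by (intro conv_summable) auto
    fix x assume x: "x \<in> carrier G"
    then show "g1 x * g2 (inv x \<otimes> z) \<le> g1 (d \<otimes> x) * g2 (inv x \<otimes> z) + ?h x * g2 (inv x \<otimes> z)"
      using g2_nonneg[of "inv x \<otimes> z"] z by (auto intro!: mult_right_mono simp flip: distrib_right)
  qed
  have sum: "conv_mass summable_on carrier G" "(\<lambda>z. conv_mass (d \<otimes> z)) summable_on carrier G"
    using conv_mass_sum has_sum_reindex_bij_betw[OF bij_betw_mult_left[OF d], of conv_mass 1]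
    by (auto simp: has_sum_iff)
  have "infsum conv_mass Z \<le> (\<Sum>\<^sub>\<infinity>z\<in>Z. conv_mass (d \<otimes> z) + ?Q z)"
    using sum Q Z le
    by (intro infsum_mono summable_on_add) (auto intro: summable_on_subset simp: has_sum_iff)
  also have "\<dots> = (\<Sum>\<^sub>\<infinity>z\<in>Z. conv_mass (d \<otimes> z)) + infsum ?Q Z"
    using sum Q Z by (intro infsum_add) (auto intro: summable_on_subset simp: has_sum_iff)
  also have "infsum ?Q Z \<le> infsum ?Q (carrier G)"
    using Q Z h g2_nonneg
    by (intro infsum_mono2) (auto intro: summable_on_subset simp: has_sum_iff intro!: infsum_nonneg)
  finally show ?thesis
    using Q by (simp add: has_sum_iff)
qed

text \<open>Some finite set F carries more than 3/4 of the mass of \<open>g1\<close>. If d is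
  outside F F^-1, then F and d^-1 F are disjoint, so d^-1 F has mass below 1/4 and
  \<open>shift_dist d\<close> exceeds 1/2. Hence the almost-periods lie in the finite set F
  F^-1.\<close>

lemma finite_small_shift_dist: "finite {d \<in> carrier G. shift_dist d \<le> 3/8}"
proof -
  obtain F where F: "finite F" "F \<subseteq> carrier G" "3/4 < sum g1 F"
  proof -
    have "\<exists>F. finite F \<and> F \<subseteq> carrier G \<and> dist (sum g1 F) (infsum g1 (carrier G)) \<le> 1/8"
      using infsum_finite_approximation[of g1 "carrier G" "1/8"] g1_sum by (auto simp: has_sum_iff)
    then obtain F where F: "finite F" "F \<subseteq> carrier G" "\<bar>sum g1 F - 1\<bar> \<le> 1/8"
      using g1_sum by (auto simp: has_sum_iff dist_real_def)
    then have "3/4 < sum g1 F"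
      by linarith
    with F show ?thesis
      using that by blast
  qed
  have "d \<in> (\<lambda>(x, y). x \<otimes> inv y) ` (F \<times> F)" if d: "d \<in> carrier G" "shift_dist d \<le> 3/8" for d
  proof (rule ccontr)
    assume "\<not> ?thesis"
    then have disj: "F \<inter> (\<lambda>x. inv d \<otimes> x) ` F = {}"
    proof (clarsimp simp: disjoint_iff)
      fix x assume x: "x \<in> F" "inv d \<otimes> x \<in> F" and n: "d \<notin> (\<lambda>(x, y). x \<otimes> inv y) ` (F \<times> F)"
      have "x \<otimes> inv (inv d \<otimes> x) = d"
        using x F d by (auto simp: inv_mult_group m_assoc[symmetric])
      then show False
        using x n by force
    qed
    have inj: "inj_on (\<lambda>x. inv d \<otimes> x) F"
      using F d by (auto intro!: inj_onI simp: subset_iff)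
    have "sum g1 F + (\<Sum>x\<in>F. g1 (inv d \<otimes> x)) = sum g1 (F \<union> (\<lambda>x. inv d \<otimes> x) ` F)"
      using F disj inj by (simp add: sum.union_disjoint sum.reindex)
    also have "\<dots> \<le> 1"
      using F d g1_nonneg by (intro finite_sum_le_has_sum[OF g1_sum]) auto
    finally have "1/2 < sum g1 F - (\<Sum>x\<in>F. g1 (inv d \<otimes> x))"
      using F by simp
    also have "\<dots> \<le> (\<Sum>x\<in>F. \<bar>g1 x - g1 (inv d \<otimes> x)\<bar>)"
      by (simp flip: sum_subtractf) (rule sum_mono, simp)
    also have "\<dots> \<le> shift_dist d"
      unfolding shift_dist_def using F d by (intro finite_sum_le_infsum shift_dist_term_summable) auto
    finally show False
      using d by simp
  qed
  then have "{d \<in> carrier G. shift_dist d \<le> 3/8} \<subseteq> (\<lambda>(x, y). x \<otimes> inv y) ` (F \<times> F)"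
    by blast
  then show ?thesis
    using F finite_subset by blast
qed

section \<open>Concentration and stability on torsion-free groups\<close>

text \<open>A dichotomy: either the set has mass at most 15/16, and then \<open>0 \<le> m\<close>
  gives the bound, or it is a single point, whose mass is at most \<open>m\<close>, and
  \<open>m \<le> 1\<close> gives the bound.\<close>

lemma conv_mass_concentrated:
  assumes tf: "torsion_free G" and m: "0 \<le> m" "m \<le> 1"
    and bound: "(\<forall>x\<in>carrier G. g1 x \<le> m) \<or> (\<forall>x\<in>carrier G. g2 x \<le> m)"
  shows "infsum conv_mass {z \<in> carrier G. 255/256 \<le> affinity z} \<le> 1 - (1 - m) / 16"
proof -
  define Z where "Z = {z \<in> carrier G. 255/256 \<le> affinity z}"
  define K where "K = {d \<in> carrier G. shift_dist d \<le> 3/8}"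
  have Z: "Z \<subseteq> carrier G"
    by (auto simp: Z_def)
  show ?thesis
  proof (cases "15/16 < infsum conv_mass Z")
    case False
    then show ?thesis
      using m unfolding Z_def[symmetric] by (simp add: field_simps)
  next
    case True
    \<comment> \<open>Self-improvement of the error: 3/4 is what subadditivity gives for a product
      of two elements of \<open>K\<close>, and it falls back to 3/8. This is what closes
      \<open>K\<close> under multiplication.\<close>
    have quot: "d \<in> K" if d: "d \<in> carrier G" "shift_dist d \<le> 3/4" for d
    proof -
      \<comment> \<open>If Z and dZ were disjoint, the total mass 1 would be at least 2 P(Z) - 3/4,
        where P is \<open>conv_mass\<close>; but this exceeds 2 (15/16) - 3/4 = 9/8.\<close>
      have "\<exists>z\<in>Z. d \<otimes> z \<in> Z"
      proof (rule ccontr)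
        assume "\<not> ?thesis"
        then have disj: "Z \<inter> (\<lambda>z. d \<otimes> z) ` Z = {}"
          by auto
        have inj: "inj_on (\<lambda>z. d \<otimes> z) Z"
          using Z d by (auto simp: inj_on_def subset_iff)
        have img: "(\<lambda>z. d \<otimes> z) ` Z \<subseteq> carrier G"
          using Z d by auto
        have sumP: "conv_mass summable_on A" if "A \<subseteq> carrier G" for A
          using conv_mass_sum that by (auto simp: has_sum_iff intro: summable_on_subset)
        have "infsum conv_mass Z + (\<Sum>\<^sub>\<infinity>z\<in>Z. conv_mass (d \<otimes> z))
            = infsum conv_mass Z + infsum conv_mass ((\<lambda>z. d \<otimes> z) ` Z)"
          using infsum_reindex[OF inj, of conv_mass] by (simp add: o_def)
        also have "\<dots> = infsum conv_mass (Z \<union> (\<lambda>z. d \<otimes> z) ` Z)"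
          using sumP[OF Z] sumP[OF img] disj by (simp add: infsum_Un_disjoint)
        also have "\<dots> \<le> infsum conv_mass (carrier G)"
          using Z img by (intro infsum_mono2 sumP conv_mass_nonneg) auto
        also have "\<dots> = 1"
          using conv_mass_sum by (simp add: has_sum_iff)
        finally show False
          using conv_mass_shift_le[OF d(1) Z] True d by simp
      qed
      then obtain z where z: "z \<in> Z" "d \<otimes> z \<in> Z"
        by blast
      have "(d \<otimes> z) \<otimes> inv z = d"
        using z Z d by (auto simp: m_assoc)
      then show ?thesis
        using shift_dist_quotient[of z "d \<otimes> z"] z d by (auto simp: Z_def K_def)
    qed
    have "subgroup K G"
    proof (rule subgroupI)
      show "K \<noteq> {}"
      proof -
        have "shift_dist \<one> = 0"
          unfolding shift_dist_def by (rule infsum_0) simp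
        then show ?thesis
          using quot[of \<one>] by auto
      qed
      fix a b assume ab: "a \<in> K" "b \<in> K"
      show "inv a \<in> K"
        using ab shift_dist_inv by (auto simp: K_def)
      show "a \<otimes> b \<in> K"
        using ab shift_dist_mult[of a b] by (intro quot) (auto simp: K_def)
    qed (auto simp: K_def)
    \<comment> \<open>Torsion-freeness enters here: \<open>K\<close> is a subgroup, and it is finite
      because \<open>g1\<close> is summable.\<close>
    then have K: "K = {\<one>}"
      using tf finite_small_shift_dist unfolding torsion_free_def K_def by blast
    have eq: "w = z" if "z \<in> Z" "w \<in> Z" for z w
    proof -
      have "w \<otimes> inv z \<in> K"
        using shift_dist_quotient[of z w] that by (auto simp: Z_def K_def)
      then have "w \<otimes> inv z = \<one>"
        using K by simp
      then show ?thesis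
        using that Z by (metis inv_equality inv_inv inv_closed subsetD)
    qed
    have "Z \<noteq> {}"
      using True by auto
    then obtain z where "Z = {z}" "z \<in> carrier G"
      using eq Z by (metis insert_subset is_singletonI' is_singleton_the_elem)
    then have "infsum conv_mass Z \<le> m"
      using conv_mass_le bound by simp
    then show ?thesis
      using m unfolding Z_def[symmetric] by (simp add: field_simps)
  qed
qed

text \<open>Off \<open>Z\<close> the factor \<open>affinity z powr s\<close> is at most
  \<open>\<sigma>\<close>, and on \<open>Z\<close> it is at most 1. The sum is thus at most
  \<open>\<sigma>\<close> plus 1 - \<open>\<sigma>\<close> times the mass of \<open>Z\<close>, which
  the concentration bound controls.\<close>

lemma stability:
  assumes tf: "torsion_free G" and m: "0 \<le> m" "m \<le> 1" and s: "0 < s"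
    and bound: "(\<forall>x\<in>carrier G. g1 x \<le> m) \<or> (\<forall>x\<in>carrier G. g2 x \<le> m)"
  shows "(\<Sum>\<^sub>\<infinity>z\<in>carrier G. conv_mass z * affinity z powr s)
    \<le> 1 - (1 - (255/256) powr s) / 16 * (1 - m)"
proof -
  define Z where "Z = {z \<in> carrier G. 255/256 \<le> affinity z}"
  define \<sigma> :: real where "\<sigma> = (255/256) powr s"
  have \<sigma>: "\<sigma> < 1"
    using powr_less_mono2[of s "255/256" 1] s by (simp add: \<sigma>_def)
  have conv_mass: "conv_mass summable_on carrier G"
    using conv_mass_sum by (simp add: has_sum_iff)
  have PZ: "((\<lambda>z. if z \<in> Z then conv_mass z else 0) has_sum infsum conv_mass Z) (carrier G)"
  proof (rule iffD2[OF has_sum_cong_neutral])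
    show "(conv_mass has_sum infsum conv_mass Z) Z"
      using conv_mass by (intro has_sum_infsum) (auto simp: Z_def intro: summable_on_subset)
  qed (auto simp: Z_def)
  have le1: "affinity z powr s \<le> 1" if "z \<in> carrier G" for z
    using that affinity_nonneg affinity_le_1 s by (intro powr_le1) auto
  have "(\<Sum>\<^sub>\<infinity>z\<in>carrier G. conv_mass z * affinity z powr s) \<le> 1 * \<sigma> + infsum conv_mass Z * (1 - \<sigma>)"
  proof (rule has_sum_mono[OF has_sum_infsum
        has_sum_add[OF has_sum_cmult_left[OF conv_mass_sum] has_sum_cmult_left[OF PZ]]])
    show "(\<lambda>z. conv_mass z * affinity z powr s) summable_on carrier G"
      using conv_mass_powr_summable s by blast
    fix z assume z: "z \<in> carrier G"
    show "conv_mass z * affinity z powr s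
        \<le> conv_mass z * \<sigma> + (if z \<in> Z then conv_mass z else 0) * (1 - \<sigma>)"
    proof (cases "z \<in> Z")
      case True
      then show ?thesis
        using le1[OF z] conv_mass_nonneg[OF z] mult_left_le[of "affinity z powr s" "conv_mass z"]
        by (simp add: algebra_simps)
    next
      case False
      then have "affinity z powr s \<le> \<sigma>"
        unfolding \<sigma>_def using z affinity_nonneg s by (intro powr_mono2) (auto simp: Z_def)
      then show ?thesis
        using False conv_mass_nonneg[OF z] by (auto intro: mult_left_mono)
    qed
  qed
  also have "\<dots> \<le> 1 * \<sigma> + (1 - (1 - m) / 16) * (1 - \<sigma>)"
    using conv_mass_concentrated[OF tf m bound] \<sigma> by (intro add_left_mono mult_right_mono) (auto simp: Z_def)
  also have "\<dots> = 1 - (1 - \<sigma>) / 16 * (1 - m)"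
    by (simp add: field_simps)
  finally show ?thesis
    by (simp add: \<sigma>_def)
qed

section \<open>Hoelder's inequality with the affinity as an extra factor\<close>

text \<open>Hoelder with the factors g1 g2, sqrt (g1 g2), g1, g2 and the exponents a + b - 1,
  \<open>\<beta>\<close>, \<open>\<mu>\<close>, \<open>\<nu>\<close>, where the sums of the factors
  are \<open>conv_mass z\<close>, \<open>affinity z\<close>, 1 and 1. It is proved termwise by
  weighted AM-GM after normalisation, which yields summability as well.\<close>

lemma conv_powr_le:
  fixes a b \<beta> :: real
  assumes ab: "1 < a + b" and \<beta>: "0 \<le> \<beta>" "\<beta> \<le> 1 - a" "\<beta> \<le> 1 - b" and z: "z \<in> carrier G"
  shows "(\<lambda>x. g1 x powr a * g2 (inv x \<otimes> z) powr b) summable_on carrier G"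
    and "(\<Sum>\<^sub>\<infinity>x\<in>carrier G. g1 x powr a * g2 (inv x \<otimes> z) powr b)
      \<le> conv_mass z powr (a + b - 1) * affinity z powr \<beta>"
proof -
  let ?t = "\<lambda>x. g1 x powr a * g2 (inv x \<otimes> z) powr b"
  have nonneg: "0 \<le> g1 x" "0 \<le> g2 (inv x \<otimes> z)" if "x \<in> carrier G" for x
    using g1_nonneg g2_nonneg that z by auto
  have "?t summable_on carrier G \<and> infsum ?t (carrier G)
      \<le> conv_mass z powr (a + b - 1) * affinity z powr \<beta>"
  proof (cases "conv_mass z = 0")
    \<comment> \<open>The normalisation divides by \<open>conv_mass z\<close> and
      \<open>affinity z\<close>, so the case where all products vanish is treated apart.\<close>
    case True
    have "g1 x * g2 (inv x \<otimes> z) = 0" if "x \<in> carrier G" for x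
      using nonneg_infsum_le_0D[OF _ conv_mass_term_summable[OF z], of x] True nonneg that
      by (auto simp: conv_mass_def)
    then have 0: "?t x = 0" if "x \<in> carrier G" for x
      using that by fastforce
    show ?thesis
      using summable_on_cong[of "carrier G" ?t "\<lambda>_. 0"] infsum_cong[of "carrier G" ?t "\<lambda>_. 0"] 0
      by simp
  next
    case False
    then have Pp: "0 < conv_mass z"
      using conv_mass_nonneg[OF z] by simp
    have Sp: "0 < affinity z"
    proof (rule ccontr)
      assume "\<not> 0 < affinity z"
      then have "affinity z \<le> 0"
        by simp
      then have "sqrt (g1 x * g2 (inv x \<otimes> z)) = 0" if "x \<in> carrier G" for x
        using nonneg_infsum_le_0D[OF _ affinity_term_summable[OF z], of x] nonneg that
        by (simp add: affinity_def)
      then have "conv_mass z = 0"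
        unfolding conv_mass_def by (intro infsum_0) simp
      then show False
        using False by simp
    qed
    define B where "B = conv_mass z powr (a + b - 1) * affinity z powr \<beta>"
    \<comment> \<open>These exponents complete the powers of \<open>g1\<close> and \<open>g2\<close>
      to exactly \<open>a\<close> and \<open>b\<close>, and the four weights to 1; the upper bounds
      on \<open>\<beta>\<close> keep them nonnegative.\<close>
    define \<mu> \<nu> where "\<mu> = 1 - b - \<beta> / 2" and "\<nu> = 1 - a - \<beta> / 2"
    have \<mu>\<nu>: "0 \<le> \<mu>" "0 \<le> \<nu>" "(a + b - 1) + \<beta> + \<mu> + \<nu> = 1"
      using \<beta> by (auto simp: \<mu>_def \<nu>_def)
    \<comment> \<open>\<open>B\<close> times the weighted arithmetic mean of the four normalised
      factors; each of these has sum 1, so the sum of \<open>?r\<close> is exactly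
      \<open>B\<close>.\<close>
    let ?r = "\<lambda>x. B * (g1 x * g2 (inv x \<otimes> z) * ((a + b - 1) / conv_mass z)
        + sqrt (g1 x * g2 (inv x \<otimes> z)) * (\<beta> / affinity z) + g1 x * \<mu> + g2 (inv x \<otimes> z) * \<nu>)"
    have "(?r has_sum B * (conv_mass z * ((a + b - 1) / conv_mass z)
        + affinity z * (\<beta> / affinity z) + 1 * \<mu> + 1 * \<nu>)) (carrier G)"
      unfolding conv_mass_def[of z] affinity_def[of z]
      by (intro has_sum_cmult_right has_sum_add has_sum_cmult_left g1_sum g2_shift
          has_sum_infsum conv_mass_term_summable affinity_term_summable z)
    also have "conv_mass z * ((a + b - 1) / conv_mass z)
        + affinity z * (\<beta> / affinity z) + 1 * \<mu> + 1 * \<nu> = 1"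
      using Pp Sp \<mu>\<nu> by simp
    finally have r: "(?r has_sum B) (carrier G)"
      by simp
    have le: "?t x \<le> ?r x" if x: "x \<in> carrier G" for x
    proof (cases "g1 x = 0 \<or> g2 (inv x \<otimes> z) = 0")
      case True
      then have "?t x = 0"
        by auto
      also have "0 \<le> ?r x"
        unfolding B_def using nonneg[OF x] Pp Sp \<beta> \<mu>\<nu> ab
        by (intro mult_nonneg_nonneg add_nonneg_nonneg divide_nonneg_nonneg) auto
      finally show ?thesis .
    next
      case False
      define u v where "u = g1 x" and "v = g2 (inv x \<otimes> z)"
      have uv: "0 < u" "0 < v"
        using False nonneg[OF x] by (auto simp: u_def v_def)
      have "u powr a * v powr b =
          B * ((u * v / conv_mass z) powr (a + b - 1) * (sqrt (u * v) / affinity z) powr \<beta>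
            * u powr \<mu> * v powr \<nu>)"
      proof -
        have "a * ln u + b * ln v = (a + b - 1) * ln (conv_mass z) + \<beta> * ln (affinity z) +
            ((a + b - 1) * (ln u + ln v - ln (conv_mass z)) + \<beta> * ((ln u + ln v) / 2 - ln (affinity z))
              + \<mu> * ln u + \<nu> * ln v)"
          by (simp add: \<mu>_def \<nu>_def field_simps)
        then show ?thesis
          using uv Pp Sp
          by (simp add: B_def powr_def ln_mult ln_div ln_sqrt del: real_sqrt_mult flip: exp_add)
      qed
      also have "\<dots> \<le> B * ((a + b - 1) * (u * v / conv_mass z) + \<beta> * (sqrt (u * v) / affinity z)
          + \<mu> * u + \<nu> * v)"
        using uv Pp Sp \<beta> \<mu>\<nu> ab
        by (intro mult_left_mono weighted_am_gm4) (auto simp: B_def)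
      finally show ?thesis
        by (simp add: u_def v_def mult.commute)
    qed
    have t: "?t summable_on carrier G"
      by (rule summable_on_comparison_test[OF has_sum_imp_summable[OF r]]) (use le in auto)
    moreover have "infsum ?t (carrier G) \<le> B"
      using has_sum_mono[OF has_sum_infsum[OF t] r] le by blast
    ultimately show ?thesis
      by (simp add: B_def)
  qed
  then show "?t summable_on carrier G"
    "infsum ?t (carrier G) \<le> conv_mass z powr (a + b - 1) * affinity z powr \<beta>"
    by auto
qed

end

section \<open>From functions in L^p to probability densities\<close>

lemma norm_le_Lp_norm:
  assumes "in_Lp G p f" "0 < p" "x \<in> carrier G"
  shows "norm (f x) \<le> Lp_norm G p f"
proof -
  have "norm (f x) powr p \<le> (\<Sum>\<^sub>\<infinity>x\<in>carrier G. norm (f x) powr p)"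
    using finite_sum_le_infsum[of "\<lambda>x. norm (f x) powr p" "carrier G" "{x}"] assms
    by (auto simp: in_Lp_def)
  then have "(norm (f x) powr p) powr (1 / p) \<le> Lp_norm G p f"
    unfolding Lp_norm_def using assms by (intro powr_mono2) auto
  then show ?thesis
    using assms by (simp add: powr_powr)
qed

text \<open>Membership in L^p bounds the values by \<open>Lp_norm\<close>, so the supremum is a
  genuine one.\<close>

lemma norm_le_Linf_norm:
  assumes "in_Lp G p f" "0 < p" "x \<in> carrier G"
  shows "norm (f x) \<le> Linf_norm G f"
  unfolding Linf_norm_def
  using norm_le_Lp_norm[OF assms(1,2)] assms(3) by (intro cSUP_upper bdd_aboveI2) auto

definition density :: "('a, 'b) monoid_scheme \<Rightarrow> real \<Rightarrow> ('a \<Rightarrow> complex) \<Rightarrow> 'a \<Rightarrow> real" where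
  "density G p f x = (norm (f x) / Lp_norm G p f) powr p"

text \<open>The sup of the density is t^p, and \<open>t \<le> 1 < p\<close> weakens it to
  \<open>t\<close>. In this way the ratio in the theorem becomes the bound on a density that
  \<open>stability\<close> expects.\<close>

lemma density_props:
  assumes f: "in_Lp G p f" and p: "1 < p" and nz: "\<exists>x\<in>carrier G. f x \<noteq> 0"
  defines "N \<equiv> Lp_norm G p f" and "t \<equiv> Linf_norm G f / Lp_norm G p f"
    and "g \<equiv> density G p f"
  shows "0 < N" "0 < t" "t \<le> 1" "(g has_sum 1) (carrier G)"
    "\<And>x. x \<in> carrier G \<Longrightarrow> 0 \<le> g x \<and> g x \<le> t"
    "\<And>x. x \<in> carrier G \<Longrightarrow> norm (f x) = N * g x powr (1 / p)"
proof -
  obtain x0 where x0: "x0 \<in> carrier G" "f x0 \<noteq> 0"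
    using nz by blast
  show N: "0 < N"
    unfolding N_def using norm_le_Lp_norm[OF f _ x0(1)] x0(2) p
    by (smt (verit) zero_less_norm_iff)
  have "0 < Linf_norm G f"
    using norm_le_Linf_norm[OF f _ x0(1)] x0(2) p by (smt (verit) zero_less_norm_iff)
  then show t: "0 < t"
    using N by (simp add: t_def N_def)
  have "Linf_norm G f \<le> N"
    unfolding Linf_norm_def N_def using x0 p norm_le_Lp_norm[OF f] by (intro cSUP_least) auto
  then show t1: "t \<le> 1"
    using N by (simp add: t_def N_def)
  have Np: "N powr p = (\<Sum>\<^sub>\<infinity>x\<in>carrier G. norm (f x) powr p)"
    unfolding N_def Lp_norm_def using p by (simp add: powr_powr infsum_nonneg)
  have "((\<lambda>x. norm (f x) powr p) has_sum N powr p) (carrier G)"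
    using f by (simp add: Np in_Lp_def)
  from has_sum_cmult_left[OF this, of "1 / N powr p"] show "(g has_sum 1) (carrier G)"
    using N by (simp add: g_def density_def[abs_def] N_def powr_divide)
  show "0 \<le> g x \<and> g x \<le> t" if x: "x \<in> carrier G" for x
  proof -
    have "norm (f x) / N \<le> t"
      using norm_le_Linf_norm[OF f _ x] p N by (simp add: t_def N_def divide_right_mono)
    then have "g x \<le> t powr p"
      unfolding g_def density_def using N p by (intro powr_mono2) (auto simp: N_def)
    also have "\<dots> \<le> t powr 1"
      using t t1 p by (intro powr_mono') auto
    finally show ?thesis
      using t by (simp add: g_def density_def)
  qed
  show "norm (f x) = N * g x powr (1 / p)" if "x \<in> carrier G" for x
    using N p by (simp add: g_def density_def N_def powr_powr)
qed

section \<open>Young's inequality with a linear gain\<close>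

lemma (in group) improved_young_linear:
  fixes p1 p2 q :: real
  assumes tf: "torsion_free G"
    and p: "1 < p1" "1 < p2" "1 < q" and pq: "1 / q = 1 / p1 + 1 / p2 - 1"
  defines "s \<equiv> min (1 - 1 / p1) (1 - 1 / p2) * q"
  defines "c \<equiv> (1 - (255/256) powr s) / (32 * q)"
  shows "improved_young p1 p2 q (\<lambda>t. 1 - c * (1 - t)) G"
  unfolding improved_young_def
proof (intro allI impI, elim conjE, goal_cases)
  case (1 f1 f2)
  define N1 N2 where "N1 = Lp_norm G p1 f1" and "N2 = Lp_norm G p2 f2"
  define t1 t2 where "t1 = Linf_norm G f1 / N1" and "t2 = Linf_norm G f2 / N2"
  define g1 g2 where "g1 = density G p1 f1" and "g2 = density G p2 f2"
  note n1 = density_props[OF 1(1) p(1) 1(3), folded N1_def g1_def, folded t1_def]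
  note n2 = density_props[OF 1(2) p(2) 1(4), folded N2_def g2_def, folded t2_def]
  interpret density_pair G g1 g2
    by unfold_locales (use n1 n2 in auto)
  define \<beta> where "\<beta> = min (1 - 1 / p1) (1 - 1 / p2)"
  have \<beta>: "0 < \<beta>" "\<beta> \<le> 1 - 1 / p1" "\<beta> \<le> 1 - 1 / p2" and s: "s = \<beta> * q" "0 < s"
    using p by (auto simp: \<beta>_def s_def)
  have r: "1 < 1 / p1 + 1 / p2"
    using pq p by (smt (verit) divide_pos_pos)
  let ?C = "\<lambda>z. \<Sum>\<^sub>\<infinity>x\<in>carrier G. g1 x powr (1 / p1) * g2 (inv x \<otimes> z) powr (1 / p2)"
  note conv = conv_powr_le[OF r less_imp_le[OF \<beta>(1)] \<beta>(2,3)]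
  have norm_has_sum: "((\<lambda>(x, y). norm (f1 x * f2 y)) has_sum N1 * N2 * ?C z) (conv_pairs G z)"
    if z: "z \<in> carrier G" for z
  proof -
    have "((\<lambda>x. N1 * N2 * (g1 x powr (1 / p1) * g2 (inv x \<otimes> z) powr (1 / p2)))
        has_sum N1 * N2 * ?C z) (carrier G)"
      by (intro has_sum_cmult_right has_sum_infsum conv z)
    also have "?this \<longleftrightarrow> ((\<lambda>x. norm (f1 x * f2 (inv x \<otimes> z))) has_sum N1 * N2 * ?C z) (carrier G)"
      using n1(6) n2(6) z by (intro has_sum_cong) (simp add: norm_mult)
    finally show ?thesis
      using has_sum_reindex_bij_betw[OF bij_betw_conv_pairs[OF z],
          of "\<lambda>(x, y). norm (f1 x * f2 y)"] by simp
  qed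
  \<comment> \<open>Here a + b - 1 = 1/q, so the q-th power turns
    \<open>conv_mass z powr (1 / q)\<close> into \<open>conv_mass z\<close> and
    \<open>\<beta>\<close> into \<open>s\<close>.\<close>
  have pointwise: "norm (convolution G f1 f2 z) powr q
      \<le> (N1 * N2) powr q * (conv_mass z * affinity z powr s)"
    if z: "z \<in> carrier G" for z
  proof -
    have "norm (convolution G f1 f2 z) \<le> N1 * N2 * ?C z"
      unfolding convolution_def using norm_has_sum[OF z]
        norm_infsum_bound[of "\<lambda>(x, y). f1 x * f2 y" "conv_pairs G z"]
      by (simp add: has_sum_iff case_prod_unfold)
    also have "\<dots> \<le> N1 * N2 * (conv_mass z powr (1 / q) * affinity z powr \<beta>)"
      using conv(2)[OF z] n1(1) n2(1) pq by (intro mult_left_mono) auto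
    finally have "norm (convolution G f1 f2 z) powr q
        \<le> (N1 * N2 * (conv_mass z powr (1 / q) * affinity z powr \<beta>)) powr q"
      using p by (intro powr_mono2) auto
    also have "\<dots> = (N1 * N2) powr q * (conv_mass z * affinity z powr s)"
      using p n1(1) n2(1) conv_mass_nonneg[OF z] by (simp add: powr_mult powr_powr s)
    finally show ?thesis .
  qed
  have sum: "(\<lambda>z. (N1 * N2) powr q * (conv_mass z * affinity z powr s)) summable_on carrier G"
    by (intro summable_on_cmult_right conv_mass_powr_summable s)
  have Lq: "in_Lp G q (convolution G f1 f2)"
    unfolding in_Lp_def by (rule summable_on_comparison_test[OF sum]) (use pointwise in auto)
  have \<sigma>: "0 < (255/256 :: real) powr s" "(255/256 :: real) powr s < 1"
    using powr_less_mono2[of s "255/256" 1] s by auto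
  \<comment> \<open>A bound on either one of the densities is enough, so this applies to
    \<open>t1\<close> and to \<open>t2\<close>, hence to the smaller of them.\<close>
  have bound: "Lp_norm G q (convolution G f1 f2) \<le> N1 * N2 * (1 - 2 * c * (1 - t))"
    if t: "0 < t" "t \<le> 1" "(\<forall>x\<in>carrier G. g1 x \<le> t) \<or> (\<forall>x\<in>carrier G. g2 x \<le> t)" for t
  proof -
    let ?k = "(1 - (255/256) powr s) / 16 * (1 - t)"
    have k: "0 \<le> ?k" "?k < 1"
    proof -
      show "0 \<le> ?k"
        using \<sigma> t by simp
      have "?k \<le> 1 / 16 * 1"
        using \<sigma> t by (intro mult_mono) auto
      then show "?k < 1"
        by simp
    qed
    have "(\<Sum>\<^sub>\<infinity>z\<in>carrier G. norm (convolution G f1 f2 z) powr q)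
        \<le> (\<Sum>\<^sub>\<infinity>z\<in>carrier G. (N1 * N2) powr q * (conv_mass z * affinity z powr s))"
      using Lq sum pointwise by (intro infsum_mono) (auto simp: in_Lp_def)
    also have "\<dots> = (N1 * N2) powr q * (\<Sum>\<^sub>\<infinity>z\<in>carrier G. conv_mass z * affinity z powr s)"
      using conv_mass_powr_summable s by (intro infsum_cmult_right) auto
    also have "\<dots> \<le> (N1 * N2) powr q * (1 - ?k)"
      using stability[OF tf _ t(2) s(2) t(3)] t(1) by (intro mult_left_mono) auto
    finally have "Lp_norm G q (convolution G f1 f2) \<le> ((N1 * N2) powr q * (1 - ?k)) powr (1 / q)"
      unfolding Lp_norm_def using p by (intro powr_mono2 infsum_nonneg) auto
    also have "\<dots> = N1 * N2 * (1 - ?k) powr (1 / q)"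
      using p k n1(1) n2(1) by (simp add: powr_mult powr_powr)
    also have "\<dots> \<le> N1 * N2 * (1 - (1 / q) * ?k)"
      using p k n1(1) n2(1) by (intro mult_left_mono powr_le_linear) auto
    also have "(1 / q) * ?k = 2 * c * (1 - t)"
      using p by (simp add: c_def field_simps)
    finally show ?thesis .
  qed
  have c: "0 \<le> c"
    using \<sigma> p by (simp add: c_def)
  define m where "m = min t1 t2"
  have m: "Lp_norm G q (convolution G f1 f2) \<le> N1 * N2 * (1 - 2 * c * (1 - m))"
    using bound[of t1] bound[of t2] n1 n2 by (auto simp: m_def min_def)
  \<comment> \<open>The gain from the smaller ratio dominates the sum of the two separate gains. The
    product of the two factors exceeds 1 minus that sum by the nonnegative cross term.\<close>
  have "c * (1 - t1) + c * (1 - t2) \<le> 2 * c * (1 - m)"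
    using c mult_left_mono[of "1 - t1" "1 - m" c] mult_left_mono[of "1 - t2" "1 - m" c]
    by (simp add: m_def)
  moreover have "0 \<le> (c * (1 - t1)) * (c * (1 - t2))"
    using c n1 n2 by simp
  ultimately have "1 - 2 * c * (1 - m) \<le> (1 - c * (1 - t1)) * (1 - c * (1 - t2))"
    by (simp add: left_diff_distrib right_diff_distrib)
  then have "N1 * N2 * (1 - 2 * c * (1 - m)) \<le> N1 * N2 * ((1 - c * (1 - t1)) * (1 - c * (1 - t2)))"
    using n1(1) n2(1) by (intro mult_left_mono) auto
  then show ?case
    using Lq m norm_has_sum unfolding N1_def N2_def t1_def t2_def
    by (auto simp: mult.assoc intro: has_sum_imp_summable)
qed

section \<open>Transfer along injective homomorphisms\<close>

lemma has_sum_inj_neutral: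
  assumes "inj_on \<psi> B" "\<psi> ` B \<subseteq> C" "\<And>x. x \<in> C - \<psi> ` B \<Longrightarrow> h x = 0"
  shows "((\<lambda>y. h (\<psi> y)) has_sum s) B \<longleftrightarrow> (h has_sum s) C"
proof -
  have "((\<lambda>y. h (\<psi> y)) has_sum s) B \<longleftrightarrow> (h has_sum s) (\<psi> ` B)"
    using has_sum_reindex[OF assms(1), of h s] by (simp add: o_def)
  also have "\<dots> \<longleftrightarrow> (h has_sum s) C"
    using assms by (intro has_sum_cong_neutral) auto
  finally show ?thesis .
qed

lemma summable_on_inj_neutral:
  assumes "inj_on \<psi> B" "\<psi> ` B \<subseteq> C" "\<And>x. x \<in> C - \<psi> ` B \<Longrightarrow> h x = 0"
  shows "(\<lambda>y. h (\<psi> y)) summable_on B \<longleftrightarrow> h summable_on C"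
  using has_sum_inj_neutral[of \<psi> B C h, OF assms] by (simp add: summable_on_def)

lemma infsum_inj_neutral:
  assumes "inj_on \<psi> B" "\<psi> ` B \<subseteq> C" "\<And>x. x \<in> C - \<psi> ` B \<Longrightarrow> h x = 0"
  shows "infsum (\<lambda>y. h (\<psi> y)) B = infsum h C"
proof (cases "h summable_on C")
  case True
  then show ?thesis
    using has_sum_inj_neutral[of \<psi> B C h, OF assms] by (auto intro: infsumI)
next
  \<comment> \<open>Divergence passes from one sum to the other, and both then have the default
    value 0.\<close>
  case False
  then show ?thesis
    using summable_on_inj_neutral[of \<psi> B C h, OF assms] by (simp add: infsum_not_exists)
qed

locale injective_hom = group_hom H G \<psi> for H :: "('b, 'c) monoid_scheme" (structure)
    and G :: "('a, 'd) monoid_scheme" (structure) and \<psi> +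
  assumes inj: "inj_on \<psi> (carrier H)"
begin

text \<open>The image of a finite subgroup is a finite subgroup of \<open>G\<close>, hence trivial,
  and injectivity carries this back.\<close>

lemma torsion_free: "torsion_free G \<Longrightarrow> torsion_free H"
  unfolding torsion_free_def
proof (intro allI impI, elim conjE)
  fix L assume tf: "\<forall>K. subgroup K G \<and> finite K \<longrightarrow> K = {\<one>\<^bsub>G\<^esub>}" and L: "subgroup L H" "finite L"
  then have "\<psi> ` L = {\<psi> \<one>\<^bsub>H\<^esub>}"
    using subgroup_img_is_subgroup[OF L(1)] by simp
  moreover have "{\<one>\<^bsub>H\<^esub>} \<subseteq> carrier H" "L \<subseteq> carrier H"
    using subgroup.subset[OF L(1)] by simp_all
  ultimately show "L = {\<one>\<^bsub>H\<^esub>}"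
    using inj_on_image_eq_iff[OF inj, of L "{\<one>\<^bsub>H\<^esub>}"] by auto
qed

lemma image_subset: "\<psi> ` carrier H \<subseteq> carrier G"
  by auto

context
  fixes f :: "'a \<Rightarrow> complex"
  assumes supp: "\<And>x. x \<in> carrier G - \<psi> ` carrier H \<Longrightarrow> f x = 0"
begin

lemma in_Lp_comp: "in_Lp H p (\<lambda>x. f (\<psi> x)) \<longleftrightarrow> in_Lp G p f"
  unfolding in_Lp_def using supp
  by (intro summable_on_inj_neutral[OF inj image_subset, of "\<lambda>x. norm (f x) powr p"]) auto

lemma Lp_norm_comp: "Lp_norm H p (\<lambda>x. f (\<psi> x)) = Lp_norm G p f"
  unfolding Lp_norm_def using supp
  by (subst infsum_inj_neutral[OF inj image_subset, of "\<lambda>x. norm (f x) powr p"]) auto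

text \<open>Outside the image \<open>f\<close> vanishes, and 0 never exceeds the norm of the value
  at the identity; so both suprema are governed by the values on the image.\<close>

lemma Linf_norm_comp:
  assumes "in_Lp G p f" "0 < p"
  shows "Linf_norm H (\<lambda>x. f (\<psi> x)) = Linf_norm G f"
proof (rule antisym)
  have ne: "carrier H \<noteq> {}" "carrier G \<noteq> {}"
    by auto
  show "Linf_norm H (\<lambda>x. f (\<psi> x)) \<le> Linf_norm G f"
    unfolding Linf_norm_def[of H] using ne norm_le_Linf_norm[OF assms] by (intro cSUP_least) auto
  have le: "norm (f (\<psi> y)) \<le> Linf_norm H (\<lambda>x. f (\<psi> x))" if "y \<in> carrier H" for y
    using norm_le_Linf_norm[of H p "\<lambda>x. f (\<psi> x)"] assms in_Lp_comp that by auto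
  show "Linf_norm G f \<le> Linf_norm H (\<lambda>x. f (\<psi> x))"
    unfolding Linf_norm_def[of G]
  proof (rule cSUP_least)
    fix x assume x: "x \<in> carrier G"
    show "norm (f x) \<le> Linf_norm H (\<lambda>x. f (\<psi> x))"
    proof (cases "x \<in> \<psi> ` carrier H")
      case True
      then show ?thesis
        using le by auto
    next
      case False
      then have "norm (f x) = 0"
        using supp x by simp
      also have "0 \<le> norm (f (\<psi> \<one>\<^bsub>H\<^esub>))"
        by simp
      also have "\<dots> \<le> Linf_norm H (\<lambda>x. f (\<psi> x))"
        by (intro le) simp
      finally show ?thesis .
    qed
  qed (use ne in auto)
qed

end

context
  fixes f1 f2 :: "'a \<Rightarrow> complex"
  assumes supp1: "\<And>x. x \<in> carrier G - \<psi> ` carrier H \<Longrightarrow> f1 x = 0"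
    and supp2: "\<And>x. x \<in> carrier G - \<psi> ` carrier H \<Longrightarrow> f2 x = 0"
begin

text \<open>The image is closed under products: a nonzero term would put both factors, and hence
  \<open>z\<close>, in the image.\<close>

lemma conv_pairs_outside:
  assumes "z \<in> carrier G - \<psi> ` carrier H" "(x, y) \<in> conv_pairs G z"
  shows "f1 x * f2 y = 0"
proof (rule ccontr)
  assume "f1 x * f2 y \<noteq> 0"
  then have "x \<in> \<psi> ` carrier H" "y \<in> \<psi> ` carrier H"
    using assms supp1[of x] supp2[of y] by (auto simp: conv_pairs_def)
  then obtain a b where "a \<in> carrier H" "b \<in> carrier H" "x = \<psi> a" "y = \<psi> b"
    by blast
  then have "z = \<psi> (a \<otimes>\<^bsub>H\<^esub> b)" "a \<otimes>\<^bsub>H\<^esub> b \<in> carrier H"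
    using assms by (auto simp: conv_pairs_def)
  then show False
    using assms by blast
qed

text \<open>A pair over \<open>\<psi> z\<close> with a nonzero term has both entries in the image,
  and injectivity makes the product of their preimages equal to \<open>z\<close>. So the convolution
  at \<open>\<psi> z\<close> can be computed in \<open>H\<close>.\<close>

lemma conv_pairs_image:
  assumes z: "z \<in> carrier H"
  shows "inj_on (map_prod \<psi> \<psi>) (conv_pairs H z)"
    and "map_prod \<psi> \<psi> ` conv_pairs H z \<subseteq> conv_pairs G (\<psi> z)"
    and "u \<in> conv_pairs G (\<psi> z) - map_prod \<psi> \<psi> ` conv_pairs H z \<Longrightarrow> f1 (fst u) * f2 (snd u) = 0"
proof -
  show "inj_on (map_prod \<psi> \<psi>) (conv_pairs H z)"
    using inj by (auto simp: inj_on_def conv_pairs_def)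
  show "map_prod \<psi> \<psi> ` conv_pairs H z \<subseteq> conv_pairs G (\<psi> z)"
    by (auto simp: conv_pairs_def)
  assume u: "u \<in> conv_pairs G (\<psi> z) - map_prod \<psi> \<psi> ` conv_pairs H z"
  show "f1 (fst u) * f2 (snd u) = 0"
  proof (rule ccontr)
    assume "f1 (fst u) * f2 (snd u) \<noteq> 0"
    then have "fst u \<in> \<psi> ` carrier H" "snd u \<in> \<psi> ` carrier H"
      using u supp1[of "fst u"] supp2[of "snd u"] by (auto simp: conv_pairs_def)
    then obtain a b where ab: "a \<in> carrier H" "b \<in> carrier H" "u = (\<psi> a, \<psi> b)"
      by (metis imageE prod.collapse)
    then have "\<psi> (a \<otimes>\<^bsub>H\<^esub> b) = \<psi> z"
      using u by (auto simp: conv_pairs_def)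
    then have "a \<otimes>\<^bsub>H\<^esub> b = z"
      using inj_onD[OF inj] ab z by auto
    then have "(a, b) \<in> conv_pairs H z"
      using ab by (auto simp: conv_pairs_def)
    then show False
      using u ab by force
  qed
qed

lemma convolution_comp:
  assumes z: "z \<in> carrier H"
  shows "convolution H (\<lambda>x. f1 (\<psi> x)) (\<lambda>x. f2 (\<psi> x)) z = convolution G f1 f2 (\<psi> z)"
  using infsum_inj_neutral[OF conv_pairs_image[OF z], of "\<lambda>u. u"]
  by (simp add: convolution_def case_prod_unfold)

lemma convolution_summable_comp:
  assumes z: "z \<in> carrier H"
  shows "(\<lambda>(x, y). norm (f1 (\<psi> x) * f2 (\<psi> y))) summable_on conv_pairs H z \<longleftrightarrow>
    (\<lambda>(x, y). norm (f1 x * f2 y)) summable_on conv_pairs G (\<psi> z)"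
  using summable_on_inj_neutral[OF conv_pairs_image(1,2)[OF z],
      of "\<lambda>u. norm (f1 (fst u) * f2 (snd u))"] conv_pairs_image(3)[OF z]
  by (simp add: case_prod_unfold)

lemma convolution_outside:
  assumes "z \<in> carrier G - \<psi> ` carrier H"
  shows "convolution G f1 f2 z = 0" "(\<lambda>(x, y). norm (f1 x * f2 y)) summable_on conv_pairs G z"
proof -
  have 0: "f1 (fst u) * f2 (snd u) = 0" if "u \<in> conv_pairs G z" for u
    using conv_pairs_outside[OF assms, of "fst u" "snd u"] that by simp
  show "convolution G f1 f2 z = 0"
    unfolding convolution_def case_prod_unfold using 0 by (rule infsum_0)
  show "(\<lambda>(x, y). norm (f1 x * f2 y)) summable_on conv_pairs G z"
    unfolding case_prod_unfold by (rule summable_on_0) (simp add: 0)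
qed

text \<open>All norms, the convolution and its summability agree on \<open>G\<close> and
  \<open>H\<close> for functions supported on the image, so the inequality passes to
  \<open>G\<close> with the same \<open>\<Lambda>\<close>.\<close>

lemma improved_young_comp:
  assumes young: "improved_young p1 p2 q \<Lambda> H" and p: "0 < p1" "0 < p2"
    and f: "in_Lp G p1 f1" "in_Lp G p2 f2" "\<exists>x\<in>carrier G. f1 x \<noteq> 0" "\<exists>x\<in>carrier G. f2 x \<noteq> 0"
  shows "(\<forall>z\<in>carrier G. (\<lambda>(x, y). norm (f1 x * f2 y)) summable_on conv_pairs G z) \<and>
    in_Lp G q (convolution G f1 f2) \<and>
    Lp_norm G q (convolution G f1 f2)
      \<le> Lp_norm G p1 f1 * Lp_norm G p2 f2
         * \<Lambda> (Linf_norm G f1 / Lp_norm G p1 f1) * \<Lambda> (Linf_norm G f2 / Lp_norm G p2 f2)"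
proof -
  let ?f1 = "\<lambda>x. f1 (\<psi> x)" and ?f2 = "\<lambda>x. f2 (\<psi> x)"
  have comp: "in_Lp H p1 ?f1" "in_Lp H p2 ?f2"
    "Lp_norm H p1 ?f1 = Lp_norm G p1 f1" "Lp_norm H p2 ?f2 = Lp_norm G p2 f2"
    "Linf_norm H ?f1 = Linf_norm G f1" "Linf_norm H ?f2 = Linf_norm G f2"
    by (rule in_Lp_comp[THEN iffD2] Lp_norm_comp Linf_norm_comp;
        fact supp1 supp2 f(1) f(2) p(1) p(2))+
  note outside = convolution_outside(1)
  have Lq: "in_Lp H q (convolution H ?f1 ?f2) \<longleftrightarrow> in_Lp G q (convolution G f1 f2)"
  proof -
    have "in_Lp H q (convolution H ?f1 ?f2) \<longleftrightarrow> in_Lp H q (\<lambda>x. convolution G f1 f2 (\<psi> x))"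
      unfolding in_Lp_def by (rule summable_on_cong) (simp add: convolution_comp)
    also have "\<dots> \<longleftrightarrow> in_Lp G q (convolution G f1 f2)"
      by (rule in_Lp_comp[OF outside])
    finally show ?thesis .
  qed
  have Nq: "Lp_norm H q (convolution H ?f1 ?f2) = Lp_norm G q (convolution G f1 f2)"
  proof -
    have "Lp_norm H q (convolution H ?f1 ?f2) = Lp_norm H q (\<lambda>x. convolution G f1 f2 (\<psi> x))"
      unfolding Lp_norm_def
      by (rule arg_cong[where f = "\<lambda>s. s powr (1 / q)"], rule infsum_cong) (simp add: convolution_comp)
    also have "\<dots> = Lp_norm G q (convolution G f1 f2)"
      by (rule Lp_norm_comp[OF outside])
    finally show ?thesis .
  qed
  have nz: "\<exists>x\<in>carrier H. ?f1 x \<noteq> 0" "\<exists>x\<in>carrier H. ?f2 x \<noteq> 0"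
    using f(3,4) supp1 supp2 by (metis DiffI imageE)+
  have concl: "(\<forall>z\<in>carrier H. (\<lambda>(x, y). norm (?f1 x * ?f2 y)) summable_on conv_pairs H z) \<and>
      in_Lp H q (convolution H ?f1 ?f2) \<and>
      Lp_norm H q (convolution H ?f1 ?f2) \<le> Lp_norm H p1 ?f1 * Lp_norm H p2 ?f2
        * \<Lambda> (Linf_norm H ?f1 / Lp_norm H p1 ?f1) * \<Lambda> (Linf_norm H ?f2 / Lp_norm H p2 ?f2)"
    by (rule young[unfolded improved_young_def, THEN spec, THEN spec, THEN mp])
      (intro conjI nz comp)
  have "(\<lambda>(x, y). norm (f1 x * f2 y)) summable_on conv_pairs G z" if "z \<in> carrier G" for z
  proof (cases "z \<in> \<psi> ` carrier H")
    case True
    then show ?thesis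
      using concl convolution_summable_comp by blast
  next
    case False
    then show ?thesis
      using convolution_outside(2) that by blast
  qed
  then show ?thesis
    using concl[THEN conjunct2] unfolding Lq Nq comp by (intro conjI ballI) simp_all
qed

end

end

section \<open>Reduction to groups of natural numbers\<close>

text \<open>Every element of the generated subgroup is the value of a finite word over
  \<open>A\<close> and its inverses, and there are countably many such words.\<close>

lemma (in group) countable_generate:
  assumes A: "A \<subseteq> carrier G" "countable A"
  shows "countable (generate G A)"
proof -
  let ?W = "lists (A \<union> m_inv G ` A)" and ?e = "\<lambda>xs. foldr (\<otimes>) xs \<one>"
  have W: "A \<union> m_inv G ` A \<subseteq> carrier G"
    using A by auto
  have closed: "?e xs \<in> carrier G" if "xs \<in> ?W" for xs
    using that W by (induction xs) auto
  have app: "?e (xs @ ys) = ?e xs \<otimes> ?e ys" if "xs \<in> ?W" "ys \<in> ?W" for xs ys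
    using that(1)
  proof (induction xs)
    case Nil
    then show ?case
      using closed[OF that(2)] by simp
  next
    case (Cons x xs)
    then show ?case
      using closed[OF that(2)] closed[of xs] W by (auto simp: m_assoc subset_iff)
  qed
  have "generate G A \<subseteq> ?e ` ?W"
  proof
    fix x assume "x \<in> generate G A"
    then show "x \<in> ?e ` ?W"
    proof induction
      case one
      have "\<one> = ?e []" by simp
      then show ?case by blast
    next
      case (incl h)
      then have "h = ?e [h]" "[h] \<in> ?W"
        using A by auto
      then show ?case by blast
    next
      case (inv h)
      then have "inv h = ?e [inv h]" "[inv h] \<in> ?W"
        using A by auto
      then show ?case by blast
    next
      case (eng h1 h2)
      then obtain xs ys where "xs \<in> ?W" "ys \<in> ?W" "h1 = ?e xs" "h2 = ?e ys"
        by blast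
      then have "h1 \<otimes> h2 = ?e (xs @ ys)" "xs @ ys \<in> ?W"
        using app by auto
      then show ?case by blast
    qed
  qed
  then show ?thesis
    using A by (meson countable_Un countable_image countable_lists countable_subset)
qed

lemma (in group) countable_subgroup_nat:
  assumes K: "subgroup K G" "countable K"
  obtains H :: "nat monoid" and \<psi> where "injective_hom H G \<psi>" "\<psi> ` carrier H = K"
proof -
  define \<phi> where "\<phi> = to_nat_on K"
  define \<psi> where "\<psi> = inv_into K \<phi>"
  \<comment> \<open>The structure of \<open>K\<close> is transported along an injection into the
    naturals. The carrier is the image of \<open>K\<close>, so that a finite \<open>K\<close> is
    covered too.\<close>
  define H where "H = \<lparr>carrier = \<phi> ` K, mult = (\<lambda>m n. \<phi> (\<psi> m \<otimes> \<psi> n)), one = \<phi> \<one>\<rparr>"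
  have inj: "inj_on \<phi> K"
    unfolding \<phi>_def by (rule inj_on_to_nat_on[OF K(2)])
  have inv: "\<psi> (\<phi> x) = x" if "x \<in> K" for x
    using inj that by (simp add: \<psi>_def)
  note K_simps = subgroup.m_closed[OF K(1)] subgroup.one_closed[OF K(1)]
    subgroup.m_inv_closed[OF K(1)] subgroup.mem_carrier[OF K(1)]
  have "group H"
  proof (rule groupI)
    fix x assume "x \<in> carrier H"
    then obtain a where a: "a \<in> K" "x = \<phi> a"
      by (auto simp: H_def)
    then have "\<phi> (inv a) \<in> carrier H" "\<phi> (inv a) \<otimes>\<^bsub>H\<^esub> x = \<one>\<^bsub>H\<^esub>"
      by (auto simp: H_def inv K_simps)
    then show "\<exists>y\<in>carrier H. y \<otimes>\<^bsub>H\<^esub> x = \<one>\<^bsub>H\<^esub>"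
      by blast
  qed (auto simp: H_def inv K_simps m_assoc)
  moreover have "\<psi> \<in> hom H G"
    by (auto simp: hom_def H_def inv K_simps)
  moreover have "inj_on \<psi> (carrier H)"
    by (auto simp: inj_on_def H_def inv)
  ultimately have "injective_hom H G \<psi>"
    using group_axioms
    by (simp add: injective_hom_def injective_hom_axioms_def group_hom_def group_hom_axioms_def)
  moreover have "\<psi> ` carrier H = K"
    by (auto simp: H_def inv image_image)
  ultimately show ?thesis
    by (rule that)
qed

lemma in_Lp_countable_support:
  assumes "in_Lp G p f"
  shows "countable {x \<in> carrier G. f x \<noteq> 0}"
  using summable_countable_real[OF assms[unfolded in_Lp_def]] by simp

text \<open>Functions in L^p have countable support, so the two supports generate a countable
  subgroup, which has a copy on the naturals. The copy depends on the functions, while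
  \<open>\<Lambda>\<close> does not.\<close>

lemma improved_young_of_nat_monoids:
  fixes G :: "'a monoid"
  assumes young: "\<And>H :: nat monoid. group H \<Longrightarrow> torsion_free H \<Longrightarrow> improved_young p1 p2 q \<Lambda> H"
    and G: "group G" "torsion_free G" and p: "0 < p1" "0 < p2"
  shows "improved_young p1 p2 q \<Lambda> G"
  unfolding improved_young_def
proof (intro allI impI, elim conjE, goal_cases)
  case (1 f1 f2)
  interpret group G by fact
  let ?A = "{x \<in> carrier G. f1 x \<noteq> 0} \<union> {x \<in> carrier G. f2 x \<noteq> 0}"
  have A: "?A \<subseteq> carrier G" "countable ?A"
    using in_Lp_countable_support[OF 1(1)] in_Lp_countable_support[OF 1(2)] by auto
  obtain H :: "nat monoid" and \<psi> where H: "injective_hom H G \<psi>" "\<psi> ` carrier H = generate G ?A"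
    using countable_subgroup_nat[OF generate_is_subgroup[OF A(1)] countable_generate[OF A]] by blast
  interpret injective_hom H G \<psi> by fact
  have supp: "f1 x = 0" "f2 x = 0" if "x \<in> carrier G - \<psi> ` carrier H" for x
    using that generate.incl[of x ?A G] unfolding H(2) by auto
  have "group H"
    using H(1) by (simp add: injective_hom_def group_hom_def)
  show ?case
    by (rule improved_young_comp[OF supp young[OF \<open>group H\<close> torsion_free[OF G(2)]] p 1])
qed

theorem theorem1p2:
  fixes p1 p2 q :: real
  assumes "1 < p1" and "1 < p2" and "1 < q"
    and "1 / q = 1 / p1 + 1 / p2 - 1"
  shows "(\<exists>(\<Lambda> :: real \<Rightarrow> real) (\<gamma> :: real) (c :: real).
            \<Lambda> ` {0<..1} \<subseteq> {0<..1} \<and> continuous_on {0<..1} \<Lambda> \<and> mono_on {0<..1} \<Lambda> \<and>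
            0 < \<gamma> \<and> 0 < c \<and>
            (\<forall>\<^sub>F t in at_left 1. \<Lambda> t \<le> 1 - c * (1 - t) powr \<gamma>) \<and>
            (\<forall>G :: nat monoid. group G \<and> torsion_free G \<longrightarrow> improved_young p1 p2 q \<Lambda> G)) \<and>
         (\<forall>\<Lambda> :: real \<Rightarrow> real.
            (\<forall>G :: nat monoid. group G \<and> torsion_free G \<longrightarrow> improved_young p1 p2 q \<Lambda> G) \<longrightarrow>
            (\<forall>G :: 'a monoid. group G \<and> torsion_free G \<longrightarrow> improved_young p1 p2 q \<Lambda> G))"
proof -
  define s where "s = min (1 - 1 / p1) (1 - 1 / p2) * q"
  define c where "c = (1 - (255/256) powr s) / (32 * q)"
  \<comment> \<open>An affine function, so the exponent \<open>\<gamma>\<close> is 1. Its values on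
    (0,1] lie above 1 - c, and \<open>c < 1\<close> keeps them positive.\<close>
  define \<Lambda> where "\<Lambda> = (\<lambda>t. 1 - c * (1 - t))"
  have "0 < s"
    using assms by (simp add: s_def)
  then have \<sigma>: "0 < (255/256 :: real) powr s" "(255/256 :: real) powr s < 1"
    using powr_less_mono2[of s "255/256" 1] by auto
  moreover have "1 - (255/256) powr s < 32 * q"
    using \<sigma>(1) assms(3) by linarith
  ultimately have c: "0 < c" "c < 1"
    using assms(3) by (auto simp: c_def)
  have range: "\<Lambda> ` {0<..1} \<subseteq> {0<..1}"
  proof (clarsimp simp: \<Lambda>_def)
    fix t :: real assume t: "0 < t" "t \<le> 1"
    have "c * (1 - t) \<le> c"
      using c t by (intro mult_left_le) auto
    then have "c * (1 - t) < 1"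
      using c by linarith
    then show "c * (1 - t) < 1 \<and> 0 \<le> c * (1 - t)"
      using c t by auto
  qed
  have mono: "mono_on {0<..1} \<Lambda>"
    using c by (auto simp: \<Lambda>_def mono_on_def)
  have cont: "continuous_on {0<..1} \<Lambda>"
    unfolding \<Lambda>_def by (intro continuous_intros)
  \<comment> \<open>To the left of 1 the base 1 - t is positive, so the power with exponent 1 is 1 -
    t itself, and equality holds.\<close>
  have ev: "\<forall>\<^sub>F t in at_left 1. \<Lambda> t \<le> 1 - c * (1 - t) powr 1"
    unfolding eventually_at_filter by (simp add: \<Lambda>_def)
  have young: "improved_young p1 p2 q \<Lambda> G" if "group G" "torsion_free G" for G :: "nat monoid"
    using group.improved_young_linear[OF that assms] by (simp add: \<Lambda>_def c_def s_def)
  have "\<Lambda> ` {0<..1} \<subseteq> {0<..1} \<and> continuous_on {0<..1} \<Lambda> \<and> mono_on {0<..1} \<Lambda> \<and>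
      0 < (1 :: real) \<and> 0 < c \<and> (\<forall>\<^sub>F t in at_left 1. \<Lambda> t \<le> 1 - c * (1 - t) powr 1) \<and>
      (\<forall>G :: nat monoid. group G \<and> torsion_free G \<longrightarrow> improved_young p1 p2 q \<Lambda> G)"
    using range mono cont ev young c by simp
  moreover have "\<forall>\<Lambda> :: real \<Rightarrow> real.
      (\<forall>G :: nat monoid. group G \<and> torsion_free G \<longrightarrow> improved_young p1 p2 q \<Lambda> G) \<longrightarrow>
      (\<forall>G :: 'a monoid. group G \<and> torsion_free G \<longrightarrow> improved_young p1 p2 q \<Lambda> G)"
  proof (intro allI impI, elim conjE)
    fix \<Lambda> :: "real \<Rightarrow> real" and G :: "'a monoid"
    assume "\<forall>H :: nat monoid. group H \<and> torsion_free H \<longrightarrow> improved_young p1 p2 q \<Lambda> H"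
      and "group G" "torsion_free G"
    then show "improved_young p1 p2 q \<Lambda> G"
      using assms(1,2) by - (rule improved_young_of_nat_monoids, simp_all)
  qed
  ultimately show ?thesis
    by blast
qed

end
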